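(* Let $\lambda_1,\ldots,\lambda_r \in \mathbb{R}$ and let $\mathbf{v}_1,\ldots,\mathbf{v}_r \in \mathbb{R}^n$ satisfy $\|\mathbf{v}_i\| = 1$ for all $i$. For $d \in \mathbb{N}$, let $\mathcal{T}_d \in S^d(\mathbb{R}^n)$ be the symmetric tensor with symmetric (not necessarily minimal) decomposition $$\mathcal{T}_d = \sum_{i=1}^r \lambda_i \mathbf{v}_i^{\otimes d}.$$ Then there exists $D \in \mathbb{N}$ such that for all $d \geq D$: if $\mathbf{v}_j$ is an eigenvector of $\mathcal{T}_d$ with a non-zero eigenvalue, then $\mathbf{v}_j$ is a robust eigenvector of $\mathcal{T}_d$.
   Context: $S^d(\mathbb{R}^n)$ is the set of real symmetric tensors of order $d$ and dimension $n$. For $\mathcal{T}\in S^d(\mathbb{R}^n)$ and $\mathbf{x}\in\mathbb{R}^n$, $\mathcal{T}\cdot\mathbf{x}^{d-1}\in\mathbb{R}^n$ is the vector with $i$-th entry $\sum_{i_1,\ldots,i_{d-1}=1}^n \mathcal{T}_{i_1\cdots i_{d-1} i}\,x_{i_1}\cdots x_{i_{d-1}}$; for $\mathcal{T}=\sum_i\lambda_i\mathbf{v}_i^{\otimes d}$ this is $\sum_i\lambda_i\langle\mathbf{v}_i,\mathbf{x}\rangle^{d-1}\mathbf{v}_i$. A vector $\mathbf{v}$ is an eigenvector of $\mathcal{T}$ with eigenvalue $\mu\in\mathbb{R}$ if $\mathcal{T}\cdot\mathbf{v}^{d-1}=\mu\mathbf{v}$. The tensor power method for $\mathcal{T}$ is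 the iteration $\mathbf{x}_{k+1}=\mathcal{T}\cdot\mathbf{x}_k^{d-1}/\|\mathcal{T}\cdot\mathbf{x}_k^{d-1}\|$ started at an initializing vector $\mathbf{x}_0\in\mathbb{R}^n$, $\mathbf{x}_0\neq 0$. Its fixed points up to sign are the unit-norm eigenvectors with non-zero eigenvalue. A robust eigenvector of $\mathcal{T}$ is an eigenvector $\mathbf{v}$ that is an attracting fixed point of the tensor power method: there exists $\epsilon>0$ such that the tensor power method converges to $\mathbf{v}$ for every initializing vector $\mathbf{x}_0$ in the ball $B_\epsilon(\mathbf{v})$ of radius $\epsilon$ centered at $\mathbf{v}$. Being a fixed point and convergence to $\mathbf{v}$ are understood up to sign, i.e. $\min(\|\mathbf{x}_k-\mathbf{v}\|,\|\mathbf{x}_k+\mathbf{v}\|)\to 0$.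
   Formalization: Added assumption: the summands λ_i v_i^{⊗d} with v_i = ±v_j do not sum to zero. Without it the claim fails, e.g. λ = (1,1,0), v = (e1, e2, (e1+e2)/√2): v_3 is an eigenvector with non-zero eigenvalue but is not robust for d ≥ 3. *)

theory Defs
  imports "HOL-Analysis.Analysis" "HOL-Library.Multiset"
begin

text \<open>A tensor is represented by its entries, indexed by lists of coordinates; a tensor of
  order \<open>d\<close> and dimension \<open>n = CARD('n)\<close> has its entries on the lists of length \<open>d\<close> and, to
  make the representation unique, is \<open>0\<close> on all other lists.\<close>

type_synonym 'n tensor = "'n list \<Rightarrow> real"

definition symmetric_tensors :: "nat \<Rightarrow> 'n::finite tensor set" where
  "symmetric_tensors d =
     {T. (\<forall>I. length I \<noteq> d \<longrightarrow> T I = 0) \<and> (\<forall>I J. mset I = mset J \<longrightarrow> T I = T J)}"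

definition tensor_power :: "nat \<Rightarrow> real ^ 'n \<Rightarrow> 'n::finite tensor" where
  "tensor_power d v = (\<lambda>I. if length I = d then (\<Prod>k\<leftarrow>I. v $ k) else 0)"

definition decomp_tensor ::
  "'i set \<Rightarrow> ('i \<Rightarrow> real) \<Rightarrow> ('i \<Rightarrow> real ^ 'n) \<Rightarrow> nat \<Rightarrow> 'n::finite tensor" where
  "decomp_tensor A lam v d = (\<lambda>I. \<Sum>i\<in>A. lam i * tensor_power d (v i) I)"

text \<open>The vector \<open>T \<cdot> x\<^sup>d\<^sup>-\<^sup>1\<close>, meaningful for \<open>T\<close> of order \<open>d \<ge> 1\<close>.\<close>

definition contract :: "nat \<Rightarrow> 'n::finite tensor \<Rightarrow> real ^ 'n \<Rightarrow> real ^ 'n" where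
  "contract d T x = (\<chi> i. \<Sum>I | length I = d - 1. T (I @ [i]) * (\<Prod>k\<leftarrow>I. x $ k))"

definition is_eigenvector :: "nat \<Rightarrow> 'n::finite tensor \<Rightarrow> real ^ 'n \<Rightarrow> real \<Rightarrow> bool" where
  "is_eigenvector d T v \<mu> \<longleftrightarrow> v \<noteq> 0 \<and> contract d T v = \<mu> *\<^sub>R v"

definition power_step :: "nat \<Rightarrow> 'n::finite tensor \<Rightarrow> real ^ 'n \<Rightarrow> real ^ 'n" where
  "power_step d T x = contract d T x /\<^sub>R norm (contract d T x)"

definition power_method :: "nat \<Rightarrow> 'n::finite tensor \<Rightarrow> real ^ 'n \<Rightarrow> nat \<Rightarrow> real ^ 'n" where
  "power_method d T x0 k = (power_step d T ^^ k) x0"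

text \<open>Convergence up to sign. The first conjunct says that no step divides by \<open>0\<close>, i.e. that the
  whole sequence is defined.\<close>

definition power_method_converges ::
  "nat \<Rightarrow> 'n::finite tensor \<Rightarrow> real ^ 'n \<Rightarrow> real ^ 'n \<Rightarrow> bool" where
  "power_method_converges d T x0 v \<longleftrightarrow>
     (\<forall>k. contract d T (power_method d T x0 k) \<noteq> 0) \<and>
     (\<lambda>k. min (norm (power_method d T x0 k - v)) (norm (power_method d T x0 k + v)))
       \<longlonglongrightarrow> 0"

definition robust_eigenvector :: "nat \<Rightarrow> 'n::finite tensor \<Rightarrow> real ^ 'n \<Rightarrow> bool" where
  "robust_eigenvector d T v \<longleftrightarrow>
     (\<exists>\<mu>. is_eigenvector d T v \<mu>) \<and>
     (power_step d T v = v \<or> power_step d T v = - v) \<and>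
     (\<exists>\<epsilon>>0. \<forall>x0\<in>ball v \<epsilon>. x0 \<noteq> 0 \<longrightarrow> power_method_converges d T x0 v)"

text \<open>The part \<open>\<Sum>\<^bsub>i \<in> A, v i = \<plusminus> v j\<^esub> lam i (v i)\<^sup>\<otimes>\<^sup>d\<close> of the decomposition collects all the
  summands proportional to \<open>(v j)\<^sup>\<otimes>\<^sup>d\<close>. If it vanishes, then \<open>v j\<close> can be deleted from the
  decomposition together with its repetitions up to sign, although it is listed there.\<close>

definition essential_component ::
  "'i set \<Rightarrow> ('i \<Rightarrow> real) \<Rightarrow> ('i \<Rightarrow> real ^ 'n) \<Rightarrow> nat \<Rightarrow> 'i \<Rightarrow> bool" where
  "essential_component A lam v d j \<longleftrightarrow>
     decomp_tensor {i \<in> A. v i = v j \<or> v i = - v j} lam v d \<noteq> (\<lambda>I::'n::finite list. 0)"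

lemma decomp_tensor_symmetric: "decomp_tensor A lam v d \<in> symmetric_tensors d"
proof -
  have "tensor_power d w I = tensor_power d w J" if "mset I = mset J" for w :: "real^'n" and I J
  proof -
    have eq: "prod_list (map (($) w) K) = prod_mset (image_mset (($) w) (mset K))" for K
      by (induction K) auto
    have "length I = length J"
      using that by (rule mset_eq_length)
    then show ?thesis
      by (simp only: tensor_power_def eq that)
  qed
  moreover have "tensor_power d w I = 0" if "length I \<noteq> d" for w :: "real^'n" and I
    using that by (simp add: tensor_power_def)
  ultimately show ?thesis
    unfolding symmetric_tensors_def decomp_tensor_def mem_Collect_eq
    by (metis (no_types, lifting) mult_zero_right sum.cong sum.neutral)
qed

lemma sum_lists_prod_list:
  fixes f :: "'n::finite \<Rightarrow> real"
  shows "(\<Sum>I | length I = m. \<Prod>k\<leftarrow>I. f k) = (\<Sum>k\<in>UNIV. f k) ^ m"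
proof (induction m)
  case 0
  then show ?case by simp
next
  case (Suc m)
  have eq: "{I::'n list. length I = Suc m} = (\<lambda>(k, I). k # I) ` (UNIV \<times> {I. length I = m})"
    by (auto simp: image_iff length_Suc_conv)
  have inj: "inj_on (\<lambda>(k, I). k # I) (UNIV \<times> {I::'n list. length I = m})"
    by (auto simp: inj_on_def)
  have "(\<Sum>I | length I = Suc m. \<Prod>k\<leftarrow>I. f k) =
      (\<Sum>(k, I)\<in>UNIV \<times> {I. length I = m}. f k * (\<Prod>k\<leftarrow>I. f k))"
    unfolding eq by (subst sum.reindex[OF inj]) (simp add: case_prod_unfold)
  also have "\<dots> = (\<Sum>k\<in>UNIV. f k) * (\<Sum>I | length I = m. \<Prod>k\<leftarrow>I. f k)"
    by (simp add: sum_product sum.cartesian_product)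
  finally show ?case
    using Suc by simp
qed

lemma contract_decomp_tensor:
  fixes v :: "'i \<Rightarrow> real ^ 'n::finite"
  assumes "d \<ge> 1"
  shows "contract d (decomp_tensor A lam v d) x = (\<Sum>i\<in>A. (lam i * (v i \<bullet> x) ^ (d - 1)) *\<^sub>R v i)"
proof -
  have mult: "(\<Prod>k\<leftarrow>I. w $ k) * (\<Prod>k\<leftarrow>I. x $ k) = (\<Prod>k\<leftarrow>I. w $ k * x $ k)"
    for w :: "real^'n" and I
    by (induction I) (auto simp: algebra_simps)
  have pow: "(\<Sum>I | length I = d - 1. tensor_power d w (I @ [k]) * (\<Prod>k\<leftarrow>I. x $ k)) =
      (w \<bullet> x) ^ (d - 1) * w $ k" for w :: "real^'n" and k
  proof -
    have "(\<Sum>I | length I = d - 1. tensor_power d w (I @ [k]) * (\<Prod>k\<leftarrow>I. x $ k)) =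
        (\<Sum>I | length I = d - 1. (\<Prod>k\<leftarrow>I. w $ k * x $ k) * w $ k)"
      using assms by (intro sum.cong) (auto simp: tensor_power_def mult[symmetric])
    also have "\<dots> = (\<Sum>I | length I = d - 1. (\<Prod>k\<leftarrow>I. w $ k * x $ k)) * w $ k"
      by (simp add: sum_distrib_right)
    finally show ?thesis
      by (simp add: sum_lists_prod_list inner_vec_def)
  qed
  show ?thesis
  proof (subst vec_eq_iff, rule allI)
    fix k
    have "contract d (decomp_tensor A lam v d) x $ k =
        (\<Sum>I | length I = d - 1. \<Sum>i\<in>A. lam i * (tensor_power d (v i) (I @ [k]) * (\<Prod>k\<leftarrow>I. x $ k)))"
      by (simp add: contract_def decomp_tensor_def sum_distrib_right mult.assoc)
    also have "\<dots> = (\<Sum>i\<in>A. lam i *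
        (\<Sum>I | length I = d - 1. tensor_power d (v i) (I @ [k]) * (\<Prod>k\<leftarrow>I. x $ k)))"
      by (subst sum.swap) (simp add: sum_distrib_left)
    finally show "contract d (decomp_tensor A lam v d) x $ k =
        (\<Sum>i\<in>A. (lam i * (v i \<bullet> x) ^ (d - 1)) *\<^sub>R v i) $ k"
      unfolding pow by (simp add: mult.assoc)
  qed
qed

lemma essential_component_if_distinct:
  fixes v :: "'i \<Rightarrow> real ^ 'n::finite"
  assumes "j \<in> A" "lam j \<noteq> 0" "v j \<noteq> 0"
    and "\<And>i. i \<in> A \<Longrightarrow> i \<noteq> j \<Longrightarrow> v i \<noteq> v j \<and> v i \<noteq> - v j"
  shows "essential_component A lam v d j"
proof -
  have eq: "{i \<in> A. v i = v j \<or> v i = - v j} = {j}"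
    using assms by auto
  obtain k where "v j $ k \<noteq> 0"
    using assms(3) by (auto simp: vec_eq_iff)
  then have "decomp_tensor {j} lam v d (replicate d k) \<noteq> 0"
    using assms(2) by (simp add: decomp_tensor_def tensor_power_def)
  then show ?thesis
    unfolding essential_component_def eq by metis
qed

end

theory Submission
  imports Defs
begin

text \<open>Put \<open>c = v\<^sub>j\<close>, write \<open>P\<close> for the orthogonal projection onto the complement of \<open>c\<close>, and
  measure the distance of \<open>x\<close> from the line \<open>\<real>c\<close> by \<open>\<parallel>P x\<parallel> / \<bar>\<langle>c, x\<rangle>\<bar>\<close>, which does not see
  scaling or sign. The summands with \<open>v\<^sub>i = \<plusminus>c\<close> contribute \<open>\<Lambda> \<langle>c, x\<rangle>\<^sup>d\<^sup>-\<^sup>1 c\<close> to \<open>T \<cdot> x\<^sup>d\<^sup>-\<^sup>1\<close>, where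
  \<open>\<Lambda> \<noteq> 0\<close> depends only on the parity of \<open>d\<close>. The other summands satisfy \<open>\<bar>\<langle>v\<^sub>i, c\<rangle>\<bar> \<le> \<rho> < 1\<close>.
  Since \<open>c\<close> is an eigenvector, their components orthogonal to \<open>c\<close> cancel at \<open>x = c\<close>, so near \<open>c\<close>
  the orthogonal part of \<open>T \<cdot> x\<^sup>d\<^sup>-\<^sup>1\<close> is controlled by differences of \<open>(d-1)\<close>-st powers of numbers
  of size at most \<open>\<sigma> < 1\<close>, a quantity of order \<open>d \<sigma>\<^sup>d\<close>. For large \<open>d\<close> each step therefore halves
  the distance from the line, on a neighbourhood independent of \<open>d\<close>.\<close>

section \<open>Cones around a line\<close>

text \<open>For unit \<open>c\<close>, \<open>t\<close> bounds the tangent of the angle between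
  \<open>x\<close> and the line spanned by \<open>c\<close>. The first clause excludes vectors
  orthogonal to \<open>c\<close>, so that membership of an image also shows that it can be
  normalized.\<close>

definition in_cone :: "'a::real_inner \<Rightarrow> real \<Rightarrow> 'a \<Rightarrow> bool" where
  "in_cone c t x \<longleftrightarrow> c \<bullet> x \<noteq> 0 \<and> norm (x - (c \<bullet> x) *\<^sub>R c) \<le> t * \<bar>c \<bullet> x\<bar>"

text \<open>Closed form of \<open>contract\<close> on a decomposed tensor of order
  \<open>Suc m\<close>; the one-step estimate thus needs neither tensor entries nor
  coordinates.\<close>

definition power_sum_map ::
  "'i set \<Rightarrow> ('i \<Rightarrow> real) \<Rightarrow> ('i \<Rightarrow> 'a::real_inner) \<Rightarrow> nat \<Rightarrow> 'a \<Rightarrow> 'a" where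
  "power_sum_map A lam v m x = (\<Sum>i\<in>A. (lam i * (v i \<bullet> x) ^ m) *\<^sub>R v i)"

lemma norm_orthogonal_part_le:
  fixes c y :: "'a::real_inner"
  assumes "norm c = 1"
  shows "norm (y - (c \<bullet> y) *\<^sub>R c) \<le> norm y"
proof (rule power2_le_imp_le)
  have "c \<bullet> c = 1"
    using assms by (simp add: norm_eq_1)
  then have "(norm (y - (c \<bullet> y) *\<^sub>R c))\<^sup>2 = (norm y)\<^sup>2 - (c \<bullet> y)\<^sup>2"
    unfolding power2_norm_eq_inner
    by (simp add: inner_diff_left inner_diff_right inner_commute power2_eq_square algebra_simps)
  then show "(norm (y - (c \<bullet> y) *\<^sub>R c))\<^sup>2 \<le> (norm y)\<^sup>2"
    by simp
qed simp

lemma in_cone_scaleR: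
  assumes "s \<noteq> 0" "in_cone c t x"
  shows "in_cone c t (s *\<^sub>R x)"
proof -
  have "s *\<^sub>R x - (c \<bullet> (s *\<^sub>R x)) *\<^sub>R c = s *\<^sub>R (x - (c \<bullet> x) *\<^sub>R c)"
    by (simp add: algebra_simps)
  then have "norm (s *\<^sub>R x - (c \<bullet> (s *\<^sub>R x)) *\<^sub>R c) = \<bar>s\<bar> * norm (x - (c \<bullet> x) *\<^sub>R c)"
    by simp
  also have "\<dots> \<le> \<bar>s\<bar> * (t * \<bar>c \<bullet> x\<bar>)"
    using assms by (intro mult_left_mono) (auto simp: in_cone_def)
  finally show ?thesis
    using assms by (simp add: in_cone_def abs_mult mult_ac)
qed

text \<open>The component along \<open>c\<close> stays above 1/2 because
  \<open>t / 2 \<le> 1 / 2\<close>; dividing by it costs the factor 2 in the radius.\<close>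

lemma in_cone_if_near:
  fixes c x :: "'a::real_inner"
  assumes c: "norm c = 1" and t: "0 < t" "t \<le> 1" and x: "dist c x < t / 2"
  shows "in_cone c t x"
proof -
  have cc: "c \<bullet> c = 1"
    using c by (simp add: norm_eq_1)
  have d: "norm (x - c) < t / 2"
    using x by (simp add: dist_norm norm_minus_commute)
  have "\<bar>c \<bullet> (x - c)\<bar> \<le> norm (x - c)"
    using Cauchy_Schwarz_ineq2[of c "x - c"] c by simp
  then have a: "c \<bullet> x > 1 / 2"
    using d t cc by (simp add: inner_diff_right)
  \<comment> \<open>The projection annihilates \<open>c\<close>, so \<open>x\<close> and
    \<open>x - c\<close> have the same orthogonal part.\<close>
  have "x - (c \<bullet> x) *\<^sub>R c = (x - c) - (c \<bullet> (x - c)) *\<^sub>R c"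
    by (simp add: inner_diff_right cc algebra_simps)
  then have "norm (x - (c \<bullet> x) *\<^sub>R c) \<le> norm (x - c)"
    by (simp only: norm_orthogonal_part_le[OF c])
  also have "\<dots> \<le> t * (1 / 2)"
    using d by simp
  also have "\<dots> \<le> t * \<bar>c \<bullet> x\<bar>"
    using a t by (intro mult_left_mono) auto
  finally show ?thesis
    using a by (simp add: in_cone_def)
qed

text \<open>The orthogonal part \<open>e\<close> and the defect \<open>1 - |a|\<close> are each at
  most \<open>t\<close>; the sign of \<open>a\<close> decides which of \<open>c\<close> and
  \<open>- c\<close> is close.\<close>

lemma unit_in_cone_near:
  fixes c x :: "'a::real_inner"
  assumes c: "norm c = 1" and x: "norm x = 1" and t: "0 \<le> t" "in_cone c t x"
  shows "min (norm (x - c)) (norm (x + c)) \<le> 2 * t"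
proof -
  define a where "a = c \<bullet> x"
  define e where "e = x - a *\<^sub>R c"
  have a1: "\<bar>a\<bar> \<le> 1"
    using Cauchy_Schwarz_ineq2[of c x] c x by (simp add: a_def)
  have "norm e \<le> t * \<bar>a\<bar>"
    using t by (simp add: in_cone_def a_def e_def)
  also have "\<dots> \<le> t"
    using a1 t mult_left_le by blast
  finally have e: "norm e \<le> t" .
  have "1 \<le> norm (a *\<^sub>R c) + norm e"
    using norm_triangle_ineq[of "a *\<^sub>R c" e] x by (simp add: e_def)
  then have a2: "1 - \<bar>a\<bar> \<le> t"
    using e c by simp
  have "x - c = e + (a - 1) *\<^sub>R c" "x + c = e + (a + 1) *\<^sub>R c"
    by (simp_all add: e_def algebra_simps)
  then have "norm (x - c) \<le> norm e + \<bar>a - 1\<bar>" "norm (x + c) \<le> norm e + \<bar>a + 1\<bar>"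
    using norm_triangle_ineq[of e "(a - 1) *\<^sub>R c"] norm_triangle_ineq[of e "(a + 1) *\<^sub>R c"] c
    by simp_all
  then show ?thesis
    using a1 a2 e by (cases "a \<ge> 0") auto
qed

section \<open>Elementary inequalities\<close>

text \<open>Dividing by \<open>s\<close> moves both numbers into [-1, 1], where the
  \<open>m\<close>-th power is Lipschitz with constant \<open>m\<close>.\<close>

lemma abs_power_diff_le:
  fixes y z s :: real
  assumes "\<bar>y\<bar> \<le> s" "\<bar>z\<bar> \<le> s"
  shows "\<bar>y ^ m - z ^ m\<bar> \<le> real m * s ^ (m - 1) * \<bar>y - z\<bar>"
proof (cases "s = 0 \<or> m = 0")
  case True
  then show ?thesis
    using assms by auto
next
  case False
  then have s: "s > 0"
    using assms by auto
  have "\<bar>(y / s) ^ m - (z / s) ^ m\<bar> \<le> real m * \<bar>y / s - z / s\<bar>"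
    using norm_power_diff[of "y / s" "z / s" m] assms s by simp
  then have "s ^ m * \<bar>(y / s) ^ m - (z / s) ^ m\<bar> \<le> s ^ m * (real m * \<bar>y / s - z / s\<bar>)"
    using s by (intro mult_left_mono) auto
  moreover have "s ^ m * \<bar>(y / s) ^ m - (z / s) ^ m\<bar> = \<bar>y ^ m - z ^ m\<bar>"
    using s by (simp add: power_divide diff_divide_distrib[symmetric] abs_divide)
  moreover have "s ^ m * (real m * \<bar>y / s - z / s\<bar>) = real m * s ^ (m - 1) * \<bar>y - z\<bar>"
    using s False by (cases m) (simp_all add: diff_divide_distrib[symmetric] abs_divide)
  ultimately show ?thesis
    by simp
qed

text \<open>Equality in Cauchy-Schwarz would make the unit vectors agree up to sign.\<close>

lemma abs_inner_unit_less_1: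
  fixes x y :: "'a::real_inner"
  assumes "norm x = 1" "norm y = 1" "x \<noteq> y" "x \<noteq> - y"
  shows "\<bar>x \<bullet> y\<bar> < 1"
proof -
  have "\<bar>x \<bullet> y\<bar> \<le> 1"
    using Cauchy_Schwarz_ineq2[of x y] assms by simp
  moreover have "\<bar>x \<bullet> y\<bar> \<noteq> 1"
    using norm_cauchy_schwarz_abs_eq[of x y] assms by auto
  ultimately show ?thesis
    by simp
qed

section \<open>Contraction in a single step\<close>

text \<open>With \<open>a = c \<bullet> x\<close>, \<open>small1\<close> bounds the orthogonal part
  of the image by \<open>L / 4 * t * |a| ^ m\<close>, and \<open>small2\<close> leaves at least
  \<open>L / 2 * |a| ^ m\<close> along \<open>c\<close>; the quotient is
  \<open>t / 2\<close>.\<close>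

lemma power_sum_map_halves_cone:
  fixes v :: "'i \<Rightarrow> 'a::real_inner"
  defines "G \<equiv> \<lambda>A c. {i \<in> A. v i = c \<or> v i = - c}"
  assumes fin: "finite A" and unit: "\<And>i. i \<in> A \<Longrightarrow> norm (v i) = 1" and c: "norm c = 1"
    and gap: "\<And>i. i \<in> A \<Longrightarrow> v i \<noteq> c \<Longrightarrow> v i \<noteq> - c \<Longrightarrow> \<bar>v i \<bullet> c\<bar> \<le> \<rho>"
    and eig: "power_sum_map A lam v m c = \<mu> *\<^sub>R c"
    and lead: "L \<le> \<bar>\<Sum>i\<in>G A c. lam i * (v i \<bullet> c) ^ Suc m\<bar>" "0 < L"
    and small1: "(\<Sum>i\<in>A. \<bar>lam i\<bar>) * (real m * \<sigma> ^ (m - 1)) \<le> L / 4"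
    and small2: "(\<Sum>i\<in>A. \<bar>lam i\<bar>) * \<sigma> ^ m \<le> L / 2"
    and t: "0 \<le> t" "\<rho> + t \<le> \<sigma>" "0 \<le> \<rho>"
    and x: "in_cone c t x"
  shows "in_cone c (t / 2) (power_sum_map A lam v m x)"
proof -
  define a where "a = c \<bullet> x"
  define e where "e = x - a *\<^sub>R c"
  define M where "M = (\<Sum>i\<in>A. \<bar>lam i\<bar>)"
  define P where "P = (\<lambda>y. y - (c \<bullet> y) *\<^sub>R c)"
  define F where "F = power_sum_map A lam v m"
  define B where "B = A - G A c"
  have M: "0 \<le> M" "(\<Sum>i\<in>B. \<bar>lam i\<bar>) \<le> M"
    unfolding M_def B_def using fin by (auto intro: sum_nonneg sum_mono2)
  have cc: "c \<bullet> c = 1"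
    using c by (simp add: norm_eq_1)
  have a0: "\<bar>a\<bar> > 0" and e: "norm e \<le> t * \<bar>a\<bar>"
    using x by (auto simp: in_cone_def a_def e_def)
  have \<sigma>: "0 \<le> \<sigma>" "\<rho> \<le> \<sigma>"
    using t by linarith+
  have x_eq: "v i \<bullet> x = (v i \<bullet> c) * a + v i \<bullet> e" for i
    by (simp add: e_def inner_diff_right)
  have B: "\<bar>v i \<bullet> e\<bar> \<le> t * \<bar>a\<bar>" "\<bar>v i \<bullet> c * a\<bar> \<le> \<sigma> * \<bar>a\<bar>" "\<bar>v i \<bullet> x\<bar> \<le> \<sigma> * \<bar>a\<bar>"
    "\<bar>v i \<bullet> c\<bar> \<le> 1" "norm (P (v i)) \<le> 1" if i: "i \<in> B" for i
  proof -
    have iA: "i \<in> A" and rho: "\<bar>v i \<bullet> c\<bar> \<le> \<rho>"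
      using i gap by (auto simp: B_def G_def)
    show ve: "\<bar>v i \<bullet> e\<bar> \<le> t * \<bar>a\<bar>"
      using Cauchy_Schwarz_ineq2[of "v i" e] unit[OF iA] e by simp
    have va: "\<bar>v i \<bullet> c * a\<bar> \<le> \<rho> * \<bar>a\<bar>"
      using rho by (simp add: abs_mult mult_right_mono)
    also have "\<dots> \<le> \<sigma> * \<bar>a\<bar>"
      using \<sigma> by (simp add: mult_right_mono)
    finally show "\<bar>v i \<bullet> c * a\<bar> \<le> \<sigma> * \<bar>a\<bar>" .
    have "\<bar>v i \<bullet> x\<bar> \<le> (\<rho> + t) * \<bar>a\<bar>"
      using va ve unfolding x_eq distrib_right by linarith
    also have "\<dots> \<le> \<sigma> * \<bar>a\<bar>"
      using t by (intro mult_right_mono) auto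
    finally show "\<bar>v i \<bullet> x\<bar> \<le> \<sigma> * \<bar>a\<bar>" .
    show "\<bar>v i \<bullet> c\<bar> \<le> 1"
      using Cauchy_Schwarz_ineq2[of "v i" c] unit[OF iA] c by simp
    show "norm (P (v i)) \<le> 1"
      using norm_orthogonal_part_le[OF c, of "v i"] unit[OF iA] by (simp add: P_def)
  qed
  have split: "(\<Sum>i\<in>A. g i) = (\<Sum>i\<in>G A c. g i) + (\<Sum>i\<in>B. g i)" for g :: "'i \<Rightarrow> 'b::real_vector"
    unfolding B_def using sum.subset_diff[of "G A c" A g] fin by (simp add: G_def add.commute)
  have P_sum: "P (\<Sum>i\<in>S. k i *\<^sub>R v i) = (\<Sum>i\<in>S. k i *\<^sub>R P (v i))" for S and k :: "'i \<Rightarrow> real"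
    by (simp add: P_def inner_sum_right scaleR_sum_left algebra_simps sum_subtractf)
  have P_G: "P (v i) = 0" if "i \<in> G A c" for i
    using that cc by (auto simp: G_def P_def)
  have PF: "P (F y) = (\<Sum>i\<in>B. (lam i * (v i \<bullet> y) ^ m) *\<^sub>R P (v i))" for y
    unfolding F_def power_sum_map_def P_sum by (subst split) (simp add: P_G)
  have "P (F c) = 0"
    using eig cc by (simp add: F_def P_def)
  \<comment> \<open>Since \<open>F\<close> is homogeneous of degree \<open>m\<close>, the inserted
    zero is \<open>P (F (a *\<^sub>R c))\<close>. Comparing \<open>x\<close> with
    \<open>a *\<^sub>R c\<close> turns each coefficient into a difference of powers, which yields
    the factor \<open>t\<close>.\<close>
  then have "P (F x) = P (F x) - a ^ m *\<^sub>R P (F c)"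
    by simp
  also have "\<dots> = (\<Sum>i\<in>B. (lam i * ((v i \<bullet> x) ^ m - (v i \<bullet> c * a) ^ m)) *\<^sub>R P (v i))"
    unfolding PF scaleR_sum_right sum_subtractf[symmetric]
    by (intro sum.cong) (simp_all add: algebra_simps power_mult_distrib)
  also have "norm \<dots> \<le> (\<Sum>i\<in>B. \<bar>lam i\<bar> * (real m * (\<sigma> * \<bar>a\<bar>) ^ (m - 1) * (t * \<bar>a\<bar>)))"
  proof (rule sum_norm_le)
    fix i assume i: "i \<in> B"
    have "\<bar>(v i \<bullet> x) ^ m - (v i \<bullet> c * a) ^ m\<bar>
        \<le> real m * (\<sigma> * \<bar>a\<bar>) ^ (m - 1) * \<bar>v i \<bullet> x - v i \<bullet> c * a\<bar>"
      using B(3,2)[OF i] by (rule abs_power_diff_le)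
    also have "\<dots> \<le> real m * (\<sigma> * \<bar>a\<bar>) ^ (m - 1) * (t * \<bar>a\<bar>)"
      using B(1)[OF i] \<sigma>(1) by (intro mult_left_mono) (simp_all add: x_eq)
    finally have "\<bar>lam i\<bar> * \<bar>(v i \<bullet> x) ^ m - (v i \<bullet> c * a) ^ m\<bar> * norm (P (v i))
        \<le> \<bar>lam i\<bar> * (real m * (\<sigma> * \<bar>a\<bar>) ^ (m - 1) * (t * \<bar>a\<bar>)) * 1"
      using \<sigma>(1) t(1) by (intro mult_mono[OF mult_left_mono B(5)[OF i]]) simp_all
    then show "norm ((lam i * ((v i \<bullet> x) ^ m - (v i \<bullet> c * a) ^ m)) *\<^sub>R P (v i))
        \<le> \<bar>lam i\<bar> * (real m * (\<sigma> * \<bar>a\<bar>) ^ (m - 1) * (t * \<bar>a\<bar>))"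
      by (simp add: abs_mult)
  qed
  also have "\<dots> = (\<Sum>i\<in>B. \<bar>lam i\<bar>) * (real m * (\<sigma> * \<bar>a\<bar>) ^ (m - 1) * (t * \<bar>a\<bar>))"
    by (simp add: sum_distrib_right)
  also have "\<dots> \<le> M * (real m * (\<sigma> * \<bar>a\<bar>) ^ (m - 1) * (t * \<bar>a\<bar>))"
    using M \<sigma> t by (intro mult_right_mono) auto
  \<comment> \<open>The extra factor \<open>|a|\<close> raises the exponent \<open>m - 1\<close> to
    \<open>m\<close>; for \<open>m = 0\<close> both sides vanish.\<close>
  also have "\<dots> = (M * (real m * \<sigma> ^ (m - 1))) * (t * \<bar>a\<bar> ^ m)"
    by (cases m) (simp_all add: power_mult_distrib)
  also have "\<dots> \<le> L / 4 * (t * \<bar>a\<bar> ^ m)"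
    using small1 t unfolding M_def by (intro mult_right_mono) auto
  finally have orth: "norm (P (F x)) \<le> L / 4 * (t * \<bar>a\<bar> ^ m)" .
  have "c \<bullet> F x = (\<Sum>i\<in>A. lam i * (v i \<bullet> x) ^ m * (v i \<bullet> c))"
    by (simp add: F_def power_sum_map_def inner_sum_right inner_commute)
  also have "\<dots> = (\<Sum>i\<in>G A c. lam i * (v i \<bullet> x) ^ m * (v i \<bullet> c))
      + (\<Sum>i\<in>B. lam i * (v i \<bullet> x) ^ m * (v i \<bullet> c))"
    by (rule split)
  \<comment> \<open>Here \<open>v i\<close> is a multiple of \<open>c\<close>, so the term is exact;
    pairing with \<open>c\<close> supplies the last factor of the exponent
    \<open>Suc m\<close>.\<close>
  also have "(\<Sum>i\<in>G A c. lam i * (v i \<bullet> x) ^ m * (v i \<bullet> c))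
      = (\<Sum>i\<in>G A c. lam i * (v i \<bullet> c) ^ Suc m) * a ^ m"
    unfolding sum_distrib_right
  proof (intro sum.cong refl)
    fix i assume "i \<in> G A c"
    then have "v i \<bullet> x = (v i \<bullet> c) * a"
      using cc by (auto simp: G_def a_def)
    then show "lam i * (v i \<bullet> x) ^ m * (v i \<bullet> c) = lam i * (v i \<bullet> c) ^ Suc m * a ^ m"
      by (simp add: power_mult_distrib)
  qed
  finally have cF: "c \<bullet> F x = (\<Sum>i\<in>G A c. lam i * (v i \<bullet> c) ^ Suc m) * a ^ m
      + (\<Sum>i\<in>B. lam i * (v i \<bullet> x) ^ m * (v i \<bullet> c))" .
  have "\<bar>\<Sum>i\<in>B. lam i * (v i \<bullet> x) ^ m * (v i \<bullet> c)\<bar> \<le> (\<Sum>i\<in>B. \<bar>lam i\<bar> * (\<sigma> * \<bar>a\<bar>) ^ m)"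
    unfolding real_norm_def[symmetric]
  proof (rule sum_norm_le)
    fix i assume i: "i \<in> B"
    have "\<bar>v i \<bullet> x\<bar> ^ m \<le> (\<sigma> * \<bar>a\<bar>) ^ m"
      using B(3)[OF i] by (intro power_mono) auto
    then have "\<bar>lam i\<bar> * \<bar>v i \<bullet> x\<bar> ^ m * \<bar>v i \<bullet> c\<bar> \<le> \<bar>lam i\<bar> * (\<sigma> * \<bar>a\<bar>) ^ m * 1"
      using \<sigma>(1) by (intro mult_mono[OF mult_left_mono B(4)[OF i]]) simp_all
    then show "norm (lam i * (v i \<bullet> x) ^ m * (v i \<bullet> c)) \<le> norm (lam i) * (\<sigma> * norm a) ^ m"
      by (simp add: abs_mult power_abs)
  qed
  also have "\<dots> = (\<Sum>i\<in>B. \<bar>lam i\<bar>) * (\<sigma> * \<bar>a\<bar>) ^ m"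
    by (simp add: sum_distrib_right)
  also have "\<dots> \<le> M * (\<sigma> * \<bar>a\<bar>) ^ m"
    using M \<sigma> by (intro mult_right_mono) auto
  also have "\<dots> = (M * \<sigma> ^ m) * \<bar>a\<bar> ^ m"
    by (simp add: power_mult_distrib)
  also have "\<dots> \<le> L / 2 * \<bar>a\<bar> ^ m"
    using small2 unfolding M_def by (intro mult_right_mono) auto
  finally have rest: "\<bar>\<Sum>i\<in>B. lam i * (v i \<bullet> x) ^ m * (v i \<bullet> c)\<bar> \<le> L / 2 * \<bar>a\<bar> ^ m" .
  have "L * \<bar>a\<bar> ^ m \<le> \<bar>(\<Sum>i\<in>G A c. lam i * (v i \<bullet> c) ^ Suc m) * a ^ m\<bar>"
    unfolding abs_mult power_abs using lead by (intro mult_right_mono) auto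
  then have main: "L / 2 * \<bar>a\<bar> ^ m \<le> \<bar>c \<bullet> F x\<bar>"
    using rest unfolding cF by linarith
  moreover have pos: "L / 2 * \<bar>a\<bar> ^ m > 0"
    using lead a0 by simp
  moreover have "norm (P (F x)) \<le> t / 2 * (L / 2 * \<bar>a\<bar> ^ m)"
    using orth by (simp add: algebra_simps)
  then have "norm (P (F x)) \<le> t / 2 * \<bar>c \<bullet> F x\<bar>"
    using mult_left_mono[OF main, of "t / 2"] t by linarith
  ultimately show ?thesis
    by (auto simp: in_cone_def F_def P_def)
qed

section \<open>The leading coefficient\<close>

lemma tensor_power_scaleR: "tensor_power d (s *\<^sub>R w) I = s ^ d * tensor_power d w I"
proof -
  have "(\<Prod>k\<leftarrow>I. (s *\<^sub>R w) $ k) = s ^ length I * (\<Prod>k\<leftarrow>I. w $ k)"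
    by (induction I) auto
  then show ?thesis
    by (simp add: tensor_power_def del: vector_scaleR_component)
qed

text \<open>Each collected \<open>v i\<close> equals
  \<open>(v i \<bullet> v j) *\<^sub>R v j\<close>, so the collected part of the tensor is this sum
  times \<open>tensor_power d (v j)\<close>.\<close>

lemma essential_component_leading_coefficient:
  assumes "norm (v j) = 1" "essential_component A lam v d j"
  shows "(\<Sum>i\<in>{i \<in> A. v i = v j \<or> v i = - v j}. lam i * (v i \<bullet> v j) ^ d) \<noteq> 0"
    (is "?S \<noteq> 0")
proof
  assume 0: "?S = 0"
  have eq: "tensor_power d (v i) I = (v i \<bullet> v j) ^ d * tensor_power d (v j) I"
    if "v i = v j \<or> v i = - v j" for i I
    using that assms(1) tensor_power_scaleR[of d "v i \<bullet> v j" "v j" I]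
    by (auto simp: norm_eq_1)
  have "decomp_tensor {i \<in> A. v i = v j \<or> v i = - v j} lam v d I
      = ?S * tensor_power d (v j) I" for I
    unfolding decomp_tensor_def sum_distrib_right
  proof (intro sum.cong refl)
    fix i assume "i \<in> {i \<in> A. v i = v j \<or> v i = - v j}"
    then have "tensor_power d (v i) I = (v i \<bullet> v j) ^ d * tensor_power d (v j) I"
      by (intro eq) simp
    then show "lam i * tensor_power d (v i) I = lam i * (v i \<bullet> v j) ^ d * tensor_power d (v j) I"
      by (simp only: mult.assoc)
  qed
  then have "decomp_tensor {i \<in> A. v i = v j \<or> v i = - v j} lam v d = (\<lambda>I. 0)"
    by (simp add: 0 fun_eq_iff)
  then show False
    using assms(2) unfolding essential_component_def by contradiction
qed

text \<open>The sum depends only on the parity of \<open>d\<close>, hence takes at most two values.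
  This makes \<open>L\<close> uniform in \<open>d\<close>.\<close>

lemma power_sign_sum_bounded_away:
  fixes s lam :: "'i \<Rightarrow> real"
  assumes "\<And>i. i \<in> A \<Longrightarrow> s i = 1 \<or> s i = - 1"
  obtains L where "L > 0"
    and "\<And>d. (\<Sum>i\<in>A. lam i * s i ^ d) \<noteq> 0 \<Longrightarrow> L \<le> \<bar>\<Sum>i\<in>A. lam i * s i ^ d\<bar>"
proof -
  define g where "g = (\<lambda>d. \<Sum>i\<in>A. lam i * s i ^ d)"
  have eq: "s i ^ d = s i ^ (d mod 2)" if "i \<in> A" for i d
    using assms[OF that] by (cases "even d") (auto simp: odd_iff_mod_2_eq_one)
  have "g d = g (d mod 2)" for d
    unfolding g_def by (intro sum.cong refl arg_cong2[where f = "(*)"] eq)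
  then have g: "g d = g 0 \<or> g d = g 1" for d
    by (metis mod2_eq_if)
  \<comment> \<open>Inserting 1 keeps the set nonempty when both values are 0.\<close>
  define L where "L = Min (insert 1 (abs ` ({g 0, g 1} - {0})))"
  show thesis
  proof
    show "L > 0"
      unfolding L_def by (subst Min_gr_iff) auto
    show "L \<le> \<bar>\<Sum>i\<in>A. lam i * s i ^ d\<bar>" if "(\<Sum>i\<in>A. lam i * s i ^ d) \<noteq> 0" for d
      unfolding L_def using that g[of d] by (intro Min_le) (auto simp: g_def)
  qed
qed

section \<open>Convergence of the iteration\<close>

text \<open>Normalization preserves cones, so the \<open>k\<close>-th iterate lies in the cone of
  width \<open>\<delta> / 2 ^ k\<close>; being a unit vector for \<open>k \<ge> 1\<close>, it is
  within twice that of \<open>c\<close> or \<open>- c\<close>.\<close>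

lemma power_method_converges_if_halves_cone:
  fixes c x0 :: "real ^ 'n::finite"
  assumes c: "norm c = 1" and \<delta>: "0 < \<delta>"
    and step: "\<And>t x. 0 \<le> t \<Longrightarrow> t \<le> \<delta> \<Longrightarrow> in_cone c t x \<Longrightarrow> in_cone c (t / 2) (contract d T x)"
    and x0: "in_cone c \<delta> x0"
  shows "power_method_converges d T x0 c"
proof -
  have cone_step: "in_cone c (t / 2) (power_step d T x)"
    if "0 \<le> t" "t \<le> \<delta>" "in_cone c t x" for t x
  proof -
    have "contract d T x \<noteq> 0"
      using step[OF that] by (auto simp: in_cone_def)
    then show ?thesis
      unfolding power_step_def using step[OF that] by (intro in_cone_scaleR) auto
  qed
  have small: "0 \<le> \<delta> / 2 ^ k" "\<delta> / 2 ^ k \<le> \<delta>" for k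
    using \<delta> by (simp_all add: divide_le_eq)
  have cone: "in_cone c (\<delta> / 2 ^ k) (power_method d T x0 k)" for k
  proof (induction k)
    case 0
    then show ?case
      using x0 by (simp add: power_method_def)
  next
    case (Suc k)
    then show ?case
      using cone_step[OF small Suc.IH] by (simp add: power_method_def mult.commute)
  qed
  have nz: "contract d T (power_method d T x0 k) \<noteq> 0" for k
    using step[OF small cone[of k]] by (auto simp: in_cone_def)
  have unit: "norm (power_method d T x0 (Suc k)) = 1" for k
    using nz[of k] by (simp add: power_method_def power_step_def)
  let ?m = "\<lambda>k. min (norm (power_method d T x0 k - c)) (norm (power_method d T x0 k + c))"
  have "?m \<longlonglongrightarrow> 0"
  proof (rule tendsto_sandwich)
    show "\<forall>\<^sub>F k in sequentially. 0 \<le> ?m k"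
      by simp
    show "\<forall>\<^sub>F k in sequentially. ?m k \<le> 2 * (\<delta> / 2 ^ k)"
      unfolding eventually_sequentially
    proof (intro exI allI impI)
      \<comment> \<open>The initial vector need not have norm 1, so the bound starts at
        \<open>k = 1\<close>.\<close>
      fix k :: nat assume "1 \<le> k"
      then have "norm (power_method d T x0 k) = 1"
        using unit[of "k - 1"] by simp
      then show "?m k \<le> 2 * (\<delta> / 2 ^ k)"
        using unit_in_cone_near[OF c _ small(1) cone] by simp
    qed
    have "(\<lambda>k. 2 * (\<delta> * (1 / 2) ^ k)) \<longlonglongrightarrow> 2 * (\<delta> * 0)"
      by (intro tendsto_intros LIMSEQ_realpow_zero) auto
    then show "(\<lambda>k. 2 * (\<delta> / 2 ^ k)) \<longlonglongrightarrow> 0"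
      by (simp add: power_divide)
  qed simp
  then show ?thesis
    using nz by (simp add: power_method_converges_def)
qed

section \<open>Constants uniform in the order\<close>

text \<open>All of \<open>\<rho>\<close>, \<open>\<delta>\<close>, \<open>\<sigma>\<close>,
  \<open>M\<close> and \<open>L\<close> are fixed before \<open>d\<close>; only the two smallness
  conditions require \<open>d\<close> to be large.\<close>

lemma eventually_robust_eigenvector:
  fixes v :: "'i \<Rightarrow> real ^ 'n::finite"
  assumes fin: "finite A" and unit: "\<And>i. i \<in> A \<Longrightarrow> norm (v i) = 1" and j: "j \<in> A"
  shows "\<forall>\<^sub>F d in sequentially. essential_component A lam v d j \<longrightarrow>
    (\<exists>\<mu>. \<mu> \<noteq> 0 \<and> is_eigenvector d (decomp_tensor A lam v d) (v j) \<mu>) \<longrightarrow>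
    robust_eigenvector d (decomp_tensor A lam v d) (v j)"
proof -
  define c where "c = v j"
  have c: "norm c = 1"
    using unit j by (simp add: c_def)
  let ?G = "{i \<in> A. v i = c \<or> v i = - c}"
  \<comment> \<open>The inserted 0 covers the case that every \<open>v i\<close> is \<open>c\<close>
    or \<open>- c\<close>.\<close>
  define \<rho> where "\<rho> = Max (insert 0 ((\<lambda>i. \<bar>v i \<bullet> c\<bar>) ` (A - ?G)))"
  \<comment> \<open>The midpoint \<open>\<sigma>\<close> of \<open>\<rho>\<close> and 1 leaves room
    \<open>\<delta>\<close> on either side: for the cone width below and for geometric decay
    above.\<close>
  define \<delta> where "\<delta> = (1 - \<rho>) / 2"
  define \<sigma> where "\<sigma> = (1 + \<rho>) / 2"
  define M where "M = (\<Sum>i\<in>A. \<bar>lam i\<bar>)"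
  have "\<rho> < 1"
    unfolding \<rho>_def using fin unit c by (subst Max_less_iff) (auto intro: abs_inner_unit_less_1)
  moreover have \<rho>0: "0 \<le> \<rho>"
    unfolding \<rho>_def using fin by (intro Max_ge) auto
  ultimately have \<delta>: "0 < \<delta>" "\<delta> \<le> 1" and \<sigma>: "0 < \<sigma>" "\<sigma> < 1" "\<rho> + \<delta> = \<sigma>"
    by (simp_all add: \<delta>_def \<sigma>_def field_simps)
  have gap: "\<bar>v i \<bullet> c\<bar> \<le> \<rho>" if "i \<in> A" "v i \<noteq> c" "v i \<noteq> - c" for i
    unfolding \<rho>_def using fin that by (intro Max_ge) auto
  have "v i \<bullet> c = 1 \<or> v i \<bullet> c = - 1" if "i \<in> ?G" for i
    using that c by (auto simp: norm_eq_1)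
  then obtain L where L: "L > 0"
    "\<And>d. (\<Sum>i\<in>?G. lam i * (v i \<bullet> c) ^ d) \<noteq> 0 \<Longrightarrow> L \<le> \<bar>\<Sum>i\<in>?G. lam i * (v i \<bullet> c) ^ d\<bar>"
    using power_sign_sum_bounded_away[of ?G "\<lambda>i. v i \<bullet> c" lam] by blast
  \<comment> \<open>Dividing by \<open>\<sigma>\<close> trades the exponent \<open>m - 1\<close> for
    \<open>m\<close>, to which the known limit of \<open>m * \<sigma> ^ m\<close> applies.\<close>
  have "(\<lambda>m. M / \<sigma> * (real m * \<sigma> ^ m)) \<longlonglongrightarrow> M / \<sigma> * 0"
    using \<sigma> by (intro tendsto_intros powser_times_n_limit_0) auto
  then have "\<forall>\<^sub>F m in sequentially. M / \<sigma> * (real m * \<sigma> ^ m) < L / 4"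
    using L by (intro order_tendstoD) auto
  moreover have "(\<lambda>m. M * \<sigma> ^ m) \<longlonglongrightarrow> M * 0"
    using \<sigma> by (intro tendsto_intros LIMSEQ_realpow_zero) auto
  then have "\<forall>\<^sub>F m in sequentially. M * \<sigma> ^ m < L / 2"
    using L by (intro order_tendstoD) auto
  \<comment> \<open>Writing the order as \<open>Suc m\<close> ensures \<open>d \<ge> 1\<close>, as
    the formula for \<open>contract\<close> requires; the shift is undone at the end.\<close>
  ultimately have "\<forall>\<^sub>F m in sequentially. essential_component A lam v (Suc m) j \<longrightarrow>
    (\<exists>\<mu>. \<mu> \<noteq> 0 \<and> is_eigenvector (Suc m) (decomp_tensor A lam v (Suc m)) (v j) \<mu>) \<longrightarrow>
    robust_eigenvector (Suc m) (decomp_tensor A lam v (Suc m)) (v j)"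
  proof eventually_elim
    case (elim m)
    show ?case
    proof (intro impI)
      let ?T = "decomp_tensor A lam v (Suc m)"
      assume ess: "essential_component A lam v (Suc m) j"
        and "\<exists>\<mu>. \<mu> \<noteq> 0 \<and> is_eigenvector (Suc m) ?T (v j) \<mu>"
      then obtain \<mu> where \<mu>: "\<mu> \<noteq> 0" "is_eigenvector (Suc m) ?T c \<mu>"
        by (auto simp: c_def)
      have T: "contract (Suc m) ?T = power_sum_map A lam v m"
        by (simp add: fun_eq_iff contract_decomp_tensor power_sum_map_def)
      have eig: "power_sum_map A lam v m c = \<mu> *\<^sub>R c"
        using \<mu> by (simp add: is_eigenvector_def T)
      have lead: "L \<le> \<bar>\<Sum>i\<in>?G. lam i * (v i \<bullet> c) ^ Suc m\<bar>"
        using essential_component_leading_coefficient[OF _ ess] c unfolding c_def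
        by (intro L(2)[unfolded c_def]) auto
      have "M * (real m * \<sigma> ^ (m - 1)) = M / \<sigma> * (real m * \<sigma> ^ m)"
        using \<sigma> by (cases m) auto
      then have small: "M * (real m * \<sigma> ^ (m - 1)) \<le> L / 4" "M * \<sigma> ^ m \<le> L / 2"
        using elim by simp_all
      have step: "in_cone c (t / 2) (contract (Suc m) ?T x)"
        if "0 \<le> t" "t \<le> \<delta>" "in_cone c t x" for t x
        unfolding T
        using that \<sigma> power_sum_map_halves_cone[OF fin unit c gap eig lead L(1)
            small[unfolded M_def] that(1) _ \<rho>0 that(3)]
        by simp
      have "power_method_converges (Suc m) ?T x0 c" if "x0 \<in> ball c (\<delta> / 2)" for x0
        using that in_cone_if_near[OF c \<delta>] power_method_converges_if_halves_cone[OF c \<delta>(1) step]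
        by simp
      \<comment> \<open>The step multiplies the unit vector \<open>c\<close> by the sign of the
        nonzero eigenvalue \<open>\<mu>\<close>.\<close>
      moreover have "power_step (Suc m) ?T c = c \<or> power_step (Suc m) ?T c = - c"
        using \<mu> c by (cases "\<mu> > 0") (auto simp: power_step_def T eig)
      moreover have "\<delta> / 2 > 0"
        using \<delta> by simp
      ultimately have "robust_eigenvector (Suc m) ?T c"
        unfolding robust_eigenvector_def using \<mu>(2) by blast
      then show "robust_eigenvector (Suc m) ?T (v j)"
        by (simp add: c_def)
    qed
  qed
  then show ?thesis
    by (subst (asm) eventually_sequentially_Suc)
qed

text \<open>Finitely many indices \<open>j\<close> allow a common threshold \<open>D\<close>.
  \<open>essential_component\<close> supplies the nonzero leading coefficient; with repetitions up
  to sign it can hold for one parity of \<open>d\<close> and fail for the other.\<close>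

theorem theorem3p1:
  fixes lam :: "nat \<Rightarrow> real" and v :: "nat \<Rightarrow> real ^ 'n::finite" and r :: nat
  assumes unit: "\<And>i. i \<in> {1..r} \<Longrightarrow> norm (v i) = 1"
  shows "\<exists>D::nat. \<forall>d\<ge>D. \<forall>j\<in>{1..r}.
    essential_component {1..r} lam v d j \<longrightarrow>
    (\<exists>\<mu>. \<mu> \<noteq> 0 \<and> is_eigenvector d (decomp_tensor {1..r} lam v d) (v j) \<mu>) \<longrightarrow>
    robust_eigenvector d (decomp_tensor {1..r} lam v d) (v j)"
  unfolding eventually_sequentially[symmetric]
  using unit by (intro eventually_ball_finite ballI eventually_robust_eigenvector) auto

end
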